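(* Let $\Psi=(\Sigma,\mathit{ind})$ be a concurrent alphabet with a total order $\le$ on $\Sigma$, and let $\sigma$ be a (sequential) trace over $\Psi$, i.e. an equivalence class of $\equiv^\Sigma_\Psi$. Then there exists a unique step trace $\tau$ over $\Psi$ such that $lex(\tau)=\sigma$.
   Context: A concurrent alphabet is $\Psi=(\Sigma,\mathit{ind})$ with $\Sigma$ finite nonempty and $\mathit{ind}$ irreflexive and symmetric. $\equiv^\Sigma_\Psi$ on $\Sigma^*$ is the reflexive transitive closure of $uabz\sim ubaz$ for $(a,b)\in\mathit{ind}$. Steps over $\Psi$: nonempty subsets of $\Sigma$ whose distinct elements are pairwise in $\mathit{ind}$. Step traces are the equivalence classes of the reflexive, symmetric, transitive closure of $uABz\sim u(A\cup B)z$ on step sequences, for steps $A,B$ with $A\times B\subseteq\mathit{ind}$. For a step $A$, $lex(A)$ lists the elements of $A$ in increasing $\le$-order; $lex(A_1\ldots A_n)=lex(A_1)\cdots lex(A_n)$; for a set $X$ of step sequences, $lex(X)=\{lex(w)\mid w\in X\}$. *)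

theory Defs
  imports Main
begin

definition concurrent_alphabet :: "'a set \<Rightarrow> ('a \<times> 'a) set \<Rightarrow> bool" where
  "concurrent_alphabet \<Sigma> ind \<longleftrightarrow>
     finite \<Sigma> \<and> \<Sigma> \<noteq> {} \<and> ind \<subseteq> \<Sigma> \<times> \<Sigma> \<and> irrefl ind \<and> sym ind"

definition seq_swap :: "'a set \<Rightarrow> ('a \<times> 'a) set \<Rightarrow> ('a list \<times> 'a list) set" where
  "seq_swap \<Sigma> ind =
     {(u @ [a, b] @ z, u @ [b, a] @ z) | u z a b.
        u \<in> lists \<Sigma> \<and> z \<in> lists \<Sigma> \<and> (a, b) \<in> ind}"

(* rtrancl contains the identity on the whole type, hence the restriction to the words over \<Sigma>. *)
definition seq_equiv :: "'a set \<Rightarrow> ('a \<times> 'a) set \<Rightarrow> ('a list \<times> 'a list) set" where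
  "seq_equiv \<Sigma> ind = Restr ((seq_swap \<Sigma> ind)\<^sup>*) (lists \<Sigma>)"

definition seq_traces :: "'a set \<Rightarrow> ('a \<times> 'a) set \<Rightarrow> 'a list set set" where
  "seq_traces \<Sigma> ind = lists \<Sigma> // seq_equiv \<Sigma> ind"

definition steps :: "'a set \<Rightarrow> ('a \<times> 'a) set \<Rightarrow> 'a set set" where
  "steps \<Sigma> ind = {A. A \<noteq> {} \<and> A \<subseteq> \<Sigma> \<and> pairwise (\<lambda>a b. (a, b) \<in> ind) A}"

definition step_merge :: "'a set \<Rightarrow> ('a \<times> 'a) set \<Rightarrow> ('a set list \<times> 'a set list) set" where
  "step_merge \<Sigma> ind =
     {(u @ [A, B] @ z, u @ [A \<union> B] @ z) | u z A B.
        u \<in> lists (steps \<Sigma> ind) \<and> z \<in> lists (steps \<Sigma> ind) \<and>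
        A \<in> steps \<Sigma> ind \<and> B \<in> steps \<Sigma> ind \<and> A \<times> B \<subseteq> ind}"

definition step_equiv :: "'a set \<Rightarrow> ('a \<times> 'a) set \<Rightarrow> ('a set list \<times> 'a set list) set" where
  "step_equiv \<Sigma> ind =
     Restr ((step_merge \<Sigma> ind \<union> (step_merge \<Sigma> ind)\<inverse>)\<^sup>*) (lists (steps \<Sigma> ind))"

definition step_traces :: "'a set \<Rightarrow> ('a \<times> 'a) set \<Rightarrow> 'a set list set set" where
  "step_traces \<Sigma> ind = lists (steps \<Sigma> ind) // step_equiv \<Sigma> ind"

definition lex_step :: "('a \<times> 'a) set \<Rightarrow> 'a set \<Rightarrow> 'a list" where
  "lex_step r A = (THE xs. set xs = A \<and> distinct xs \<and> sorted_wrt (\<lambda>a b. (a, b) \<in> r) xs)"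

definition lex_seq :: "('a \<times> 'a) set \<Rightarrow> 'a set list \<Rightarrow> 'a list" where
  "lex_seq r w = concat (map (lex_step r) w)"

lemma lex_step_ex1:
  assumes "linear_order_on \<Sigma> r" "finite A" "A \<subseteq> \<Sigma>"
  shows "\<exists>!xs. set xs = A \<and> distinct xs \<and> sorted_wrt (\<lambda>a b. (a, b) \<in> r) xs"
  using assms(2,3)
proof (induction "card A" arbitrary: A)
  case 0
  then show ?case by auto
next
  case (Suc n)
  have trans: "trans r" and anti: "antisym r" and tot: "total_on \<Sigma> r" and refl: "refl_on \<Sigma> r"
    using assms(1) unfolding linear_order_on_def partial_order_on_def preorder_on_def by auto
  have ex: "\<exists>m\<in>B. \<forall>x\<in>B. (m, x) \<in> r" if "finite B" "B \<noteq> {}" "B \<subseteq> \<Sigma>" for B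
    using that
  proof (induction B rule: finite_ne_induct)
    case (singleton x)
    then show ?case using refl by (auto simp: refl_on_def)
  next
    case (insert x F)
    then obtain m where m: "m \<in> F" "\<forall>y\<in>F. (m, y) \<in> r" by auto
    have xx: "(x, x) \<in> r" using insert.prems refl by (auto simp: refl_on_def)
    have "x \<noteq> m" using m insert.hyps by auto
    then consider "(x, m) \<in> r" | "(m, x) \<in> r"
      using tot m insert.prems by (auto simp: total_on_def)
    then show ?case
    proof cases
      case 1
      then have "\<forall>y\<in>insert x F. (x, y) \<in> r" using m xx trans by (auto dest: transD)
      then show ?thesis by blast
    next
      case 2
      then show ?thesis using m by blast
    qed
  qed
  have "A \<noteq> {}" using Suc.hyps(2) by auto
  then obtain m where m: "m \<in> A" "\<forall>x\<in>A. (m, x) \<in> r" using ex Suc.prems by blast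
  have "n = card (A - {m})" using Suc.hyps(2) m Suc.prems by simp
  from Suc.hyps(1)[OF this] Suc.prems
  have IH: "\<exists>!xs. set xs = A - {m} \<and> distinct xs \<and> sorted_wrt (\<lambda>a b. (a, b) \<in> r) xs" by auto
  then obtain xs where xs: "set xs = A - {m}" "distinct xs" "sorted_wrt (\<lambda>a b. (a, b) \<in> r) xs"
    by blast
  show ?case
  proof (rule ex1I)
    show "set (m # xs) = A \<and> distinct (m # xs) \<and> sorted_wrt (\<lambda>a b. (a, b) \<in> r) (m # xs)"
      using xs m by auto
  next
    fix ys assume ys: "set ys = A \<and> distinct ys \<and> sorted_wrt (\<lambda>a b. (a, b) \<in> r) ys"
    then obtain y zs where [simp]: "ys = y # zs" using m by (cases ys) auto
    have "y = m"
    proof (rule ccontr)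
      assume "y \<noteq> m"
      then have "m \<in> set zs" using ys m by auto
      then have "(y, m) \<in> r" using ys by auto
      moreover have "(m, y) \<in> r" using m ys by auto
      ultimately show False using anti \<open>y \<noteq> m\<close> by (auto dest: antisymD)
    qed
    moreover have "set zs = A - {y} \<and> distinct zs \<and> sorted_wrt (\<lambda>a b. (a, b) \<in> r) zs"
      using ys by auto
    ultimately show "ys = m # xs" using IH xs by auto
  qed
qed

lemma equiv_seq_equiv:
  assumes "concurrent_alphabet \<Sigma> ind"
  shows "equiv (lists \<Sigma>) (seq_equiv \<Sigma> ind)"
proof -
  have "sym (seq_swap \<Sigma> ind)"
    using assms unfolding concurrent_alphabet_def seq_swap_def sym_def by blast
  then have "sym ((seq_swap \<Sigma> ind)\<^sup>*)" by (rule sym_rtrancl)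
  then show ?thesis
    unfolding seq_equiv_def
    by (intro equivI) (auto simp: refl_on_def sym_def trans_def intro: rtrancl_trans)
qed

lemma equiv_step_equiv: "equiv (lists (steps \<Sigma> ind)) (step_equiv \<Sigma> ind)"
proof -
  have "sym ((step_merge \<Sigma> ind \<union> (step_merge \<Sigma> ind)\<inverse>)\<^sup>*)"
    by (intro sym_rtrancl sym_Un_converse)
  then show ?thesis
    unfolding step_equiv_def
    by (intro equivI) (auto simp: refl_on_def sym_def trans_def intro: rtrancl_trans)
qed

end

theory Submission
  imports Defs
begin

text \<open>A step sequence is step-equivalent to the sequence of singletons of its \<open>lex\<close>-word, because
  each step splits into singletons in any order. Two step sequences are therefore step-equivalent
  exactly when their \<open>lex\<close>-words are trace-equivalent: a swap of words is a merge followed by a split,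
  and a merge only permutes pairwise independent letters of the \<open>lex\<close>-word. Hence \<open>lex\<close> and
  the embedding of words as sequences of singletons induce mutually inverse maps on classes.\<close>

definition singleton_steps :: "'a list \<Rightarrow> 'a set list" where
  "singleton_steps v = map (\<lambda>a. {a}) v"

lemma singleton_steps_simps [simp]:
  "singleton_steps [] = []"
  "singleton_steps (a # v) = {a} # singleton_steps v"
  "singleton_steps (u @ v) = singleton_steps u @ singleton_steps v"
  by (simp_all add: singleton_steps_def)

section \<open>Compatibility of both equivalences with concatenation\<close>

lemma rtrancl_list_context:
  assumes "\<And>x y. (x, y) \<in> R \<Longrightarrow> (u @ x @ z, u @ y @ z) \<in> R" and "(x, y) \<in> R\<^sup>*"
  shows "(u @ x @ z, u @ y @ z) \<in> R\<^sup>*"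
  using assms(2)
proof induction
  case base
  show ?case by simp
next
  case (step y w)
  then show ?case using assms(1) rtrancl_into_rtrancl by metis
qed

lemma seq_swap_context:
  assumes "(x, y) \<in> (seq_swap \<Sigma> ind)\<^sup>*" "u \<in> lists \<Sigma>" "z \<in> lists \<Sigma>"
  shows "(u @ x @ z, u @ y @ z) \<in> (seq_swap \<Sigma> ind)\<^sup>*"
proof (rule rtrancl_list_context[OF _ assms(1)])
  fix x y assume "(x, y) \<in> seq_swap \<Sigma> ind"
  then obtain u' z' a b where *: "x = u' @ [a, b] @ z'" "y = u' @ [b, a] @ z'"
    "u' \<in> lists \<Sigma>" "z' \<in> lists \<Sigma>" "(a, b) \<in> ind"
    unfolding seq_swap_def by blast
  have "u @ x @ z = (u @ u') @ [a, b] @ (z' @ z)" "u @ y @ z = (u @ u') @ [b, a] @ (z' @ z)"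
    using * by simp_all
  moreover have "u @ u' \<in> lists \<Sigma>" "z' @ z \<in> lists \<Sigma>"
    using * assms by auto
  ultimately show "(u @ x @ z, u @ y @ z) \<in> seq_swap \<Sigma> ind"
    unfolding seq_swap_def using *(5) by blast
qed

lemma step_merge_context:
  assumes "(x, y) \<in> (step_merge \<Sigma> ind \<union> (step_merge \<Sigma> ind)\<inverse>)\<^sup>*"
    and "u \<in> lists (steps \<Sigma> ind)" "z \<in> lists (steps \<Sigma> ind)"
  shows "(u @ x @ z, u @ y @ z) \<in> (step_merge \<Sigma> ind \<union> (step_merge \<Sigma> ind)\<inverse>)\<^sup>*"
proof (rule rtrancl_list_context[OF _ assms(1)])
  \<comment> \<open>Only the merging direction needs an argument; the splitting direction follows by
    exchanging \<open>x\<close> and \<open>y\<close>.\<close>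
  have "(u @ x @ z, u @ y @ z) \<in> step_merge \<Sigma> ind" if xy: "(x, y) \<in> step_merge \<Sigma> ind" for x y
  proof -
    obtain u' z' A B where *: "x = u' @ [A, B] @ z'" "y = u' @ [A \<union> B] @ z'"
      "u' \<in> lists (steps \<Sigma> ind)" "z' \<in> lists (steps \<Sigma> ind)"
      "A \<in> steps \<Sigma> ind" "B \<in> steps \<Sigma> ind" "A \<times> B \<subseteq> ind"
      using xy unfolding step_merge_def by blast
    have "u @ x @ z = (u @ u') @ [A, B] @ (z' @ z)" "u @ y @ z = (u @ u') @ [A \<union> B] @ (z' @ z)"
      using * by simp_all
    moreover have "u @ u' \<in> lists (steps \<Sigma> ind)" "z' @ z \<in> lists (steps \<Sigma> ind)"
      using * assms by auto
    ultimately show ?thesis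
      unfolding step_merge_def using *(5-7) by blast
  qed
  then show "(u @ x @ z, u @ y @ z) \<in> step_merge \<Sigma> ind \<union> (step_merge \<Sigma> ind)\<inverse>"
    if "(x, y) \<in> step_merge \<Sigma> ind \<union> (step_merge \<Sigma> ind)\<inverse>" for x y
    using that by auto
qed

lemma seq_equiv_context:
  assumes "(x, y) \<in> seq_equiv \<Sigma> ind" "u \<in> lists \<Sigma>" "z \<in> lists \<Sigma>"
  shows "(u @ x @ z, u @ y @ z) \<in> seq_equiv \<Sigma> ind"
proof -
  have "(x, y) \<in> (seq_swap \<Sigma> ind)\<^sup>*" and xy: "x \<in> lists \<Sigma>" "y \<in> lists \<Sigma>"
    using assms(1) unfolding seq_equiv_def by blast+
  from seq_swap_context[OF this(1) assms(2,3)] show ?thesis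
    unfolding seq_equiv_def using xy assms(2,3) by auto
qed

lemma step_equiv_context:
  assumes "(x, y) \<in> step_equiv \<Sigma> ind" "u \<in> lists (steps \<Sigma> ind)" "z \<in> lists (steps \<Sigma> ind)"
  shows "(u @ x @ z, u @ y @ z) \<in> step_equiv \<Sigma> ind"
proof -
  have "(x, y) \<in> (step_merge \<Sigma> ind \<union> (step_merge \<Sigma> ind)\<inverse>)\<^sup>*"
    and xy: "x \<in> lists (steps \<Sigma> ind)" "y \<in> lists (steps \<Sigma> ind)"
    using assms(1) unfolding step_equiv_def by blast+
  from step_merge_context[OF this(1) assms(2,3)] show ?thesis
    unfolding step_equiv_def using xy assms(2,3) by auto
qed

section \<open>Letters, steps and lex words over a fixed ordered alphabet\<close>

locale ordered_concurrent_alphabet =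
  fixes \<Sigma> :: "'a set" and ind r :: "('a \<times> 'a) set"
  assumes alphabet: "concurrent_alphabet \<Sigma> ind"
    and order: "linear_order_on \<Sigma> r"
begin

lemma ind_in_alphabet: "(a, b) \<in> ind \<Longrightarrow> a \<in> \<Sigma> \<and> b \<in> \<Sigma>"
  and ind_sym: "(a, b) \<in> ind \<Longrightarrow> (b, a) \<in> ind"
  and ind_irrefl: "(a, a) \<notin> ind"
  and finite_alphabet: "finite \<Sigma>"
  using alphabet unfolding concurrent_alphabet_def irrefl_def sym_def by auto

lemma singleton_in_steps [simp]: "{a} \<in> steps \<Sigma> ind \<longleftrightarrow> a \<in> \<Sigma>"
  by (simp add: steps_def)

lemma singleton_steps_in_lists [simp]:
  "singleton_steps v \<in> lists (steps \<Sigma> ind) \<longleftrightarrow> v \<in> lists \<Sigma>"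
  by (induction v) auto

lemma seq_equiv_refl: "v \<in> lists \<Sigma> \<Longrightarrow> (v, v) \<in> seq_equiv \<Sigma> ind"
  and seq_equiv_sym: "(v, w) \<in> seq_equiv \<Sigma> ind \<Longrightarrow> (w, v) \<in> seq_equiv \<Sigma> ind"
  and seq_equiv_trans [trans]:
    "(u, v) \<in> seq_equiv \<Sigma> ind \<Longrightarrow> (v, w) \<in> seq_equiv \<Sigma> ind \<Longrightarrow> (u, w) \<in> seq_equiv \<Sigma> ind"
  using equiv_seq_equiv[OF alphabet] by (auto simp: equiv_def dest: refl_onD symD transD)

lemma step_equiv_refl: "v \<in> lists (steps \<Sigma> ind) \<Longrightarrow> (v, v) \<in> step_equiv \<Sigma> ind"
  and step_equiv_sym: "(v, w) \<in> step_equiv \<Sigma> ind \<Longrightarrow> (w, v) \<in> step_equiv \<Sigma> ind"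
  and step_equiv_trans [trans]:
    "(u, v) \<in> step_equiv \<Sigma> ind \<Longrightarrow> (v, w) \<in> step_equiv \<Sigma> ind \<Longrightarrow> (u, w) \<in> step_equiv \<Sigma> ind"
  using equiv_step_equiv[of \<Sigma> ind] by (auto simp: equiv_def dest: refl_onD symD transD)

text \<open>Resolves the definite description in \<open>lex_step\<close>: a step is finite, being a
  subset of the finite alphabet, so \<open>lex_step_ex1\<close> applies.\<close>

lemma lex_step:
  assumes "A \<in> steps \<Sigma> ind"
  shows "set (lex_step r A) = A" "distinct (lex_step r A)"
proof -
  have "A \<subseteq> \<Sigma>" using assms by (auto simp: steps_def)
  then have "\<exists>!xs. set xs = A \<and> distinct xs \<and> sorted_wrt (\<lambda>a b. (a, b) \<in> r) xs"
    by (intro lex_step_ex1[OF order] finite_subset[OF _ finite_alphabet])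
  from theI'[OF this] show "set (lex_step r A) = A" "distinct (lex_step r A)"
    unfolding lex_step_def by auto
qed

lemma lex_step_singleton:
  assumes "a \<in> \<Sigma>"
  shows "lex_step r {a} = [a]"
proof -
  have "set (lex_step r {a}) = {a}" "distinct (lex_step r {a})"
    using lex_step[of "{a}"] assms by auto
  then have "length (lex_step r {a}) = 1"
    by (metis distinct_card card_1_singleton_iff One_nat_def)
  then show ?thesis
    using \<open>set (lex_step r {a}) = {a}\<close> by (auto simp: length_Suc_conv)
qed

text \<open>In this order the two maps compose to the identity exactly; in the other order they do
  so only up to \<open>step_equiv\<close>, see
  \<open>step_equiv_singleton_steps_lex_seq\<close>.\<close>

lemma lex_seq_singleton_steps: "v \<in> lists \<Sigma> \<Longrightarrow> lex_seq r (singleton_steps v) = v"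
  by (induction v) (auto simp: lex_seq_def lex_step_singleton)

lemma lex_seq_in_lists: "w \<in> lists (steps \<Sigma> ind) \<Longrightarrow> lex_seq r w \<in> lists \<Sigma>"
  by (auto simp: lex_seq_def lex_step in_lists_conv_set) (auto simp: steps_def)

section \<open>Permuting independent letters within a word\<close>

lemma seq_equiv_swap:
  assumes "(a, b) \<in> ind"
  shows "([a, b], [b, a]) \<in> seq_equiv \<Sigma> ind"
proof -
  have "([] @ [a, b] @ [], [] @ [b, a] @ []) \<in> seq_swap \<Sigma> ind"
    unfolding seq_swap_def using assms by blast
  then show ?thesis
    unfolding seq_equiv_def using ind_in_alphabet[OF assms] by auto
qed

lemma seq_equiv_move_front:
  assumes "a \<in> \<Sigma>" "p \<in> lists \<Sigma>" "\<forall>b\<in>set p. (b, a) \<in> ind"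
  shows "(p @ [a], a # p) \<in> seq_equiv \<Sigma> ind"
  using assms(2,3)
proof (induction p)
  case Nil
  show ?case using assms(1) by (auto intro: seq_equiv_refl)
next
  case (Cons b p)
  \<comment> \<open>The induction hypothesis brings \<open>a\<close> directly behind
    \<open>b\<close>; one more swap then carries it past \<open>b\<close>.\<close>
  then have "([b] @ (p @ [a]) @ [], [b] @ (a # p) @ []) \<in> seq_equiv \<Sigma> ind"
    by (intro seq_equiv_context) auto
  moreover have "([] @ [b, a] @ p, [] @ [a, b] @ p) \<in> seq_equiv \<Sigma> ind"
    using Cons by (intro seq_equiv_context seq_equiv_swap) auto
  ultimately show ?case
    using seq_equiv_trans by auto
qed

text \<open>The head \<open>a\<close> of \<open>xs\<close> occurs in \<open>ys\<close> as
  \<open>p @ a # q\<close>. It is independent of all letters of \<open>p\<close>, hence can be moved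
  to the front of \<open>ys\<close>, and the induction hypothesis relates the tail of
  \<open>xs\<close> to \<open>p @ q\<close>.\<close>

lemma seq_equiv_permute_independent:
  assumes "set xs = set ys" "distinct xs" "distinct ys" "xs \<in> lists \<Sigma>"
    and "pairwise (\<lambda>a b. (a, b) \<in> ind) (set xs)"
  shows "(xs, ys) \<in> seq_equiv \<Sigma> ind"
  using assms
proof (induction xs arbitrary: ys)
  case Nil
  then show ?case by (auto intro: seq_equiv_refl)
next
  case (Cons a xs)
  then have "a \<in> set ys" by auto
  then obtain p q where ys: "ys = p @ a # q" by (auto simp: in_set_conv_decomp)
  have ysl: "ys \<in> lists \<Sigma>"
    using Cons.prems(1,4) by (auto simp: in_lists_conv_set)
  have pq: "set xs = set (p @ q)" "distinct (p @ q)"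
    using Cons.prems(1-3) ys by auto
  have "(xs, p @ q) \<in> seq_equiv \<Sigma> ind"
    using Cons.prems pq by (intro Cons.IH) (auto intro: pairwise_subset)
  then have "([a] @ xs @ [], [a] @ (p @ q) @ []) \<in> seq_equiv \<Sigma> ind"
    using Cons.prems by (intro seq_equiv_context) auto
  moreover have "([] @ (p @ [a]) @ q, [] @ (a # p) @ q) \<in> seq_equiv \<Sigma> ind"
  proof (intro seq_equiv_context seq_equiv_move_front)
    \<comment> \<open>Since \<open>ys\<close> is distinct, \<open>a\<close> does not occur in
      \<open>p\<close>, so pairwise independence applies to \<open>b\<close> and
      \<open>a\<close>.\<close>
    show "\<forall>b\<in>set p. (b, a) \<in> ind"
      using Cons.prems(5) Cons.prems(1,3) ys unfolding pairwise_def by auto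
  qed (use ysl ys in auto)
  ultimately have "(a # xs, a # p @ q) \<in> seq_equiv \<Sigma> ind" "(ys, a # p @ q) \<in> seq_equiv \<Sigma> ind"
    using ys by simp_all
  then show ?case
    by (blast intro: seq_equiv_trans seq_equiv_sym)
qed

section \<open>Merging and splitting steps\<close>

lemma step_Un:
  assumes "A \<in> steps \<Sigma> ind" "B \<in> steps \<Sigma> ind" "A \<times> B \<subseteq> ind"
  shows "A \<union> B \<in> steps \<Sigma> ind"
  using assms unfolding steps_def pairwise_def by (auto dest: ind_sym)

lemma step_equiv_merge:
  assumes "A \<in> steps \<Sigma> ind" "B \<in> steps \<Sigma> ind" "A \<times> B \<subseteq> ind"
  shows "([A, B], [A \<union> B]) \<in> step_equiv \<Sigma> ind"
proof -
  have "([] @ [A, B] @ [], [] @ [A \<union> B] @ []) \<in> step_merge \<Sigma> ind"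
    unfolding step_merge_def using assms by blast
  then show ?thesis
    unfolding step_equiv_def using assms step_Un by auto
qed

text \<open>The singletons are merged from the right: first those of the tail into one step, then
  the head into that step. The order of \<open>xs\<close> is arbitrary, so the lex order is just one
  instance.\<close>

lemma step_equiv_split_step:
  assumes "distinct xs" "set xs \<in> steps \<Sigma> ind"
  shows "(singleton_steps xs, [set xs]) \<in> step_equiv \<Sigma> ind"
  using assms
proof (induction xs)
  case Nil
  then show ?case by (simp add: steps_def)
next
  case (Cons a xs)
  show ?case
  \<comment> \<open>With an empty tail there is nothing to merge: the empty set is not a step, but
    both sides already coincide.\<close>
  proof (cases "xs = []")
    case True
    then show ?thesis using Cons.prems by (auto intro: step_equiv_refl)
  next
    case False
    have a: "a \<in> \<Sigma>" and xs: "set xs \<in> steps \<Sigma> ind" and ax: "{a} \<times> set xs \<subseteq> ind"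
      using Cons.prems False by (auto simp: steps_def pairwise_def)
    then have "([{a}] @ singleton_steps xs @ [], [{a}] @ [set xs] @ []) \<in> step_equiv \<Sigma> ind"
      using Cons by (intro step_equiv_context) auto
    moreover have "([{a}, set xs], [{a} \<union> set xs]) \<in> step_equiv \<Sigma> ind"
      using a xs ax by (intro step_equiv_merge) auto
    ultimately show ?thesis
      using step_equiv_trans by auto
  qed
qed

text \<open>The lex word thus determines a step sequence up to equivalence, which is the source of
  uniqueness.\<close>

lemma step_equiv_singleton_steps_lex_seq:
  assumes "w \<in> lists (steps \<Sigma> ind)"
  shows "(singleton_steps (lex_seq r w), w) \<in> step_equiv \<Sigma> ind"
  using assms
proof induction
  case Nil
  then show ?case by (auto simp: lex_seq_def intro: step_equiv_refl)
next
  case (Cons A w)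
  have "(singleton_steps (lex_step r A), [A]) \<in> step_equiv \<Sigma> ind"
    using step_equiv_split_step[of "lex_step r A"] lex_step[OF Cons.hyps(1)] Cons.hyps(1) by simp
  then have "([] @ singleton_steps (lex_step r A) @ singleton_steps (lex_seq r w),
      [] @ [A] @ singleton_steps (lex_seq r w)) \<in> step_equiv \<Sigma> ind"
    using Cons.hyps lex_seq_in_lists by (intro step_equiv_context) auto
  moreover have "([A] @ singleton_steps (lex_seq r w) @ [], [A] @ w @ []) \<in> step_equiv \<Sigma> ind"
    using Cons by (intro step_equiv_context) auto
  ultimately show ?case
    using step_equiv_trans by (auto simp: lex_seq_def)
qed

section \<open>Transfer of equivalences and classes between words and step sequences\<close>

lemma step_equiv_singleton_steps:
  assumes "(v, v') \<in> seq_equiv \<Sigma> ind"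
  shows "(singleton_steps v, singleton_steps v') \<in> step_equiv \<Sigma> ind"
proof -
  have "(v, v') \<in> (seq_swap \<Sigma> ind)\<^sup>*" "v \<in> lists \<Sigma>"
    using assms unfolding seq_equiv_def by blast+
  then show ?thesis
  proof induction
    case base
    then show ?case by (simp only: step_equiv_refl singleton_steps_in_lists)
  next
    case (step y z)
    then obtain u t a b where *: "y = u @ [a, b] @ t" "z = u @ [b, a] @ t"
      "u \<in> lists \<Sigma>" "t \<in> lists \<Sigma>" "(a, b) \<in> ind"
      unfolding seq_swap_def by blast
    have ab: "a \<in> \<Sigma>" "b \<in> \<Sigma>" "(b, a) \<in> ind"
      using *(5) ind_in_alphabet ind_sym by auto
    \<comment> \<open>Both orders of the two singletons merge into the same step, which links
      them.\<close>
    have "([{a}, {b}], [{a} \<union> {b}]) \<in> step_equiv \<Sigma> ind"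
      "([{b}, {a}], [{b} \<union> {a}]) \<in> step_equiv \<Sigma> ind"
      using * ab by (intro step_equiv_merge; simp)+
    then have "([{a}, {b}], [{b}, {a}]) \<in> step_equiv \<Sigma> ind"
      by (metis (no_types) step_equiv_trans step_equiv_sym Un_commute)
    then have "(singleton_steps u @ [{a}, {b}] @ singleton_steps t,
        singleton_steps u @ [{b}, {a}] @ singleton_steps t) \<in> step_equiv \<Sigma> ind"
      using * by (intro step_equiv_context) auto
    then have "(singleton_steps y, singleton_steps z) \<in> step_equiv \<Sigma> ind"
      using * by simp
    with step show ?case
      using step_equiv_trans by blast
  qed
qed

text \<open>Before and after the merge, the affected segment of the lex word lists the letters of
  the step \<open>A \<union> B\<close> without repetition, so the two segments differ by a
  permutation of pairwise independent letters.\<close>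

lemma seq_equiv_lex_seq_merge:
  assumes "(w, w') \<in> step_merge \<Sigma> ind"
  shows "(lex_seq r w, lex_seq r w') \<in> seq_equiv \<Sigma> ind"
proof -
  obtain u z A B where *: "w = u @ [A, B] @ z" "w' = u @ [A \<union> B] @ z"
    "u \<in> lists (steps \<Sigma> ind)" "z \<in> lists (steps \<Sigma> ind)"
    and AB: "A \<in> steps \<Sigma> ind" "B \<in> steps \<Sigma> ind" "A \<times> B \<subseteq> ind"
    using assms unfolding step_merge_def by blast
  note U = step_Un[OF AB]
  \<comment> \<open>A common letter would be independent of itself. Disjointness makes
    \<open>lex_step r A @ lex_step r B\<close> distinct.\<close>
  have "A \<inter> B = {}" using AB(3) ind_irrefl by blast
  then have "(lex_step r A @ lex_step r B, lex_step r (A \<union> B)) \<in> seq_equiv \<Sigma> ind"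
    using lex_step[OF AB(1)] lex_step[OF AB(2)] lex_step[OF U] U
    by (intro seq_equiv_permute_independent) (auto simp: steps_def in_lists_conv_set)
  then have "(lex_seq r u @ (lex_step r A @ lex_step r B) @ lex_seq r z,
      lex_seq r u @ lex_step r (A \<union> B) @ lex_seq r z) \<in> seq_equiv \<Sigma> ind"
    using * lex_seq_in_lists by (intro seq_equiv_context) auto
  then show ?thesis
    using * by (simp add: lex_seq_def)
qed

lemma seq_equiv_lex_seq:
  assumes "(w, w') \<in> step_equiv \<Sigma> ind"
  shows "(lex_seq r w, lex_seq r w') \<in> seq_equiv \<Sigma> ind"
proof -
  have "(w, w') \<in> (step_merge \<Sigma> ind \<union> (step_merge \<Sigma> ind)\<inverse>)\<^sup>*" "w \<in> lists (steps \<Sigma> ind)"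
    using assms unfolding step_equiv_def by blast+
  then show ?thesis
  proof induction
    case base
    then show ?case using lex_seq_in_lists seq_equiv_refl by blast
  next
    case (step y z)
    then have "(lex_seq r y, lex_seq r z) \<in> seq_equiv \<Sigma> ind"
      using seq_equiv_lex_seq_merge seq_equiv_sym by blast
    with step show ?case
      using seq_equiv_trans by blast
  qed
qed

text \<open>The existence half. Invariance of lex words under \<open>step_equiv\<close> gives one
  inclusion; for the other, each \<open>x\<close> equivalent to \<open>v\<close> is the lex word of
  \<open>singleton_steps x\<close>, which lies in the class of
  \<open>singleton_steps v\<close>.\<close>

lemma lex_seq_image_class:
  assumes v: "v \<in> lists \<Sigma>"
  shows "lex_seq r ` (step_equiv \<Sigma> ind `` {singleton_steps v}) = seq_equiv \<Sigma> ind `` {v}"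
proof (intro equalityI subsetI)
  fix x assume "x \<in> lex_seq r ` (step_equiv \<Sigma> ind `` {singleton_steps v})"
  then show "x \<in> seq_equiv \<Sigma> ind `` {v}"
    using seq_equiv_lex_seq lex_seq_singleton_steps[OF v] by force
next
  fix x assume x: "x \<in> seq_equiv \<Sigma> ind `` {v}"
  then have "x = lex_seq r (singleton_steps x)"
    using lex_seq_singleton_steps by (auto simp: seq_equiv_def)
  then show "x \<in> lex_seq r ` (step_equiv \<Sigma> ind `` {singleton_steps v})"
    using x step_equiv_singleton_steps by blast
qed

text \<open>The uniqueness half. A representative \<open>w\<close> has a lex word equivalent to
  \<open>v\<close>; passing to singletons and regrouping them into the steps of \<open>w\<close>
  puts \<open>w\<close> in the class of \<open>singleton_steps v\<close>.\<close>

lemma step_trace_eq_class: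
  assumes "\<tau> \<in> step_traces \<Sigma> ind" "lex_seq r ` \<tau> = seq_equiv \<Sigma> ind `` {v}"
  shows "\<tau> = step_equiv \<Sigma> ind `` {singleton_steps v}"
proof -
  obtain w where w: "w \<in> lists (steps \<Sigma> ind)" and \<tau>: "\<tau> = step_equiv \<Sigma> ind `` {w}"
    using assms(1) unfolding step_traces_def by (auto elim!: quotientE)
  have "w \<in> \<tau>" using w \<tau> step_equiv_refl by blast
  then have "(v, lex_seq r w) \<in> seq_equiv \<Sigma> ind" using assms(2) by blast
  then have "(singleton_steps v, w) \<in> step_equiv \<Sigma> ind"
    using step_equiv_singleton_steps step_equiv_singleton_steps_lex_seq[OF w] step_equiv_trans
    by blast
  then show ?thesis
    using equiv_class_eq[OF equiv_step_equiv] \<tau> by metis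
qed

end

theorem theorem2p12:
  fixes \<Sigma> :: "'a set" and ind r :: "('a \<times> 'a) set" and \<sigma> :: "'a list set"
  assumes "concurrent_alphabet \<Sigma> ind"
    and "linear_order_on \<Sigma> r"
    and "\<sigma> \<in> seq_traces \<Sigma> ind"
  shows "\<exists>!\<tau>. \<tau> \<in> step_traces \<Sigma> ind \<and> lex_seq r ` \<tau> = \<sigma>"
proof -
  interpret ordered_concurrent_alphabet \<Sigma> ind r
    using assms(1,2) by unfold_locales
  obtain v where v: "v \<in> lists \<Sigma>" and \<sigma>: "\<sigma> = seq_equiv \<Sigma> ind `` {v}"
    using assms(3) unfolding seq_traces_def by (auto elim!: quotientE)
  show ?thesis
  proof (rule ex1I)
    \<comment> \<open>The witness is the class obtained by reading a representative \<open>v\<close>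
      of \<open>\<sigma>\<close> one letter per step.\<close>
    show "step_equiv \<Sigma> ind `` {singleton_steps v} \<in> step_traces \<Sigma> ind \<and>
        lex_seq r ` (step_equiv \<Sigma> ind `` {singleton_steps v}) = \<sigma>"
      using v \<sigma> lex_seq_image_class unfolding step_traces_def
      by (metis quotientI singleton_steps_in_lists)
  next
    fix \<tau> assume "\<tau> \<in> step_traces \<Sigma> ind \<and> lex_seq r ` \<tau> = \<sigma>"
    then show "\<tau> = step_equiv \<Sigma> ind `` {singleton_steps v}"
      using step_trace_eq_class \<sigma> by blast
  qed
qed

end
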